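(* For $t\in\mathbb{R}$ let $$\varphi(t)=\log\frac{F\big(\tfrac12,\tfrac12;1;\frac{e^{t/2}}{1+e^{t/2}}\big)}{F\big(\tfrac12,\tfrac12;1;\frac{1}{1+e^{t/2}}\big)}.$$ Then the function $\varphi(t)/t$ is strictly decreasing on $(0,\infty)$, which implies that $\varphi$ is subadditive on $(0,\infty)$, i.e. $\varphi(t+t')\le\varphi(t)+\varphi(t')$ for all $t,t'>0$.
   Context: $F(a,b;c;x)=\sum_{n=0}^\infty \frac{(a,n)(b,n)}{(c,n)}\frac{x^n}{n!}$ for $|x|<1$ is the Gaussian hypergeometric function, where $(a,0)=1$ and $(a,n)=a(a+1)\cdots(a+n-1)$ for $n\ge1$. Equivalently, $\varphi(t)=2\Phi(e^{t/2})$, where $\Phi(x)=\frac12\log\frac{\mathcal{K}(r)}{\mathcal{K}(r')}$ with $r=\sqrt{x/(1+x)}$, $r'=\sqrt{1/(1+x)}$, and $\mathcal{K}(r)=\frac{\pi}{2}F(\frac12,\frac12;1;r^2)$ is the complete elliptic integral of the first kind. *)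

theory Defs
  imports "HOL-Analysis.Analysis"
begin

text \<open>
  The Gaussian hypergeometric function. The series is meant for \<open>\<bar>x\<bar> < 1\<close> and
  \<open>c\<close> not a non-positive integer; elsewhere the value carries no meaning.
\<close>

definition hypergeo_F :: "real \<Rightarrow> real \<Rightarrow> real \<Rightarrow> real \<Rightarrow> real" where
  "hypergeo_F a b c x =
     (\<Sum>n. pochhammer a n * pochhammer b n / pochhammer c n * (x ^ n / fact n))"

lemma hypergeo_F_eq_eval_fps: "hypergeo_F a b c x = eval_fps (fps_hypergeo [a, b] [c] 1) x"
  by (simp add: hypergeo_F_def eval_fps_def mult_ac)

text \<open>Both arguments of \<^const>\<open>hypergeo_F\<close> below lie in \<open>(0,1)\<close> for every real \<open>t\<close>.\<close>

definition phi :: "real \<Rightarrow> real" where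
  "phi t =
     ln (hypergeo_F (1/2) (1/2) 1 (exp (t/2) / (1 + exp (t/2))) /
         hypergeo_F (1/2) (1/2) 1 (1 / (1 + exp (t/2))))"

end

theory Submission
  imports Defs
begin

text \<open>
  Write \<open>f\<close> for \<open>F(1/2, 1/2; 1; \<cdot>)\<close>, a multiple of the complete elliptic integral of the first
  kind as a function of \<open>x = r\<^sup>2\<close>. With \<open>x = e\<^bsup>t/2\<^esup> / (1 + e\<^bsup>t/2\<^esup>)\<close> one has
  \<open>\<phi>(t) = ln f(x) - ln f(1 - x)\<close> and \<open>dx/dt = x (1 - x) / 2\<close>. The point is that \<open>\<phi>\<close> is strictly
  concave on \<open>[0, \<infinity>)\<close> with \<open>\<phi>(0) = 0\<close>, so that the slopes \<open>\<phi>(t) / t\<close> of its chords from the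
  origin decrease strictly; a function with decreasing \<open>\<phi>(t) / t\<close> is subadditive.

  Two facts about \<open>f\<close> give the concavity. Both \<open>f(x)\<close> and \<open>f(1 - x)\<close> solve the self-adjoint
  equation \<open>(x (1 - x) y')' = y / 4\<close>, so their weighted Wronskian
  \<open>W = x (1 - x) (f'(x) f(1 - x) + f(x) f'(1 - x))\<close> is a positive constant
  (\<open>ellK_wronskian_const\<close>; this is a form of Legendre's relation). The chain rule thus yields \<open>\<phi>'(t) = W / (2 f(x) f(1 - x))\<close>
  (\<open>has_derivative_phi\<close>). Secondly, \<open>f\<close> is strictly log-convex (\<open>ellK_log_convex\<close>), whence
  \<open>ln f(x) + ln f(1 - x)\<close>, which is symmetric about \<open>1/2\<close>, increases strictly for \<open>x \<ge> 1/2\<close>, that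
  is for \<open>t \<ge> 0\<close> (\<open>ellK_complement_product_strict_mono\<close>). So \<open>\<phi>'\<close> decreases strictly there.
\<close>

section \<open>Log-convexity of power series\<close>

lemma has_field_derivative_powser:
  fixes a :: "nat \<Rightarrow> real"
  assumes "\<And>y. \<bar>y\<bar> < r \<Longrightarrow> summable (\<lambda>n. a n * y ^ n)" and "\<bar>x\<bar> < r"
  shows "((\<lambda>y. \<Sum>n. a n * y ^ n) has_field_derivative (\<Sum>n. diffs a n * x ^ n)) (at x)"
  using termdiffs_strong'[of r a x] assms by simp

lemma summable_diffs_powser:
  fixes a :: "nat \<Rightarrow> real"
  assumes "\<And>y. \<bar>y\<bar> < r \<Longrightarrow> summable (\<lambda>n. a n * y ^ n)" and "\<bar>x\<bar> < r"
  shows "summable (\<lambda>n. diffs a n * x ^ n)"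
  using termdiff_converges[of x r a] assms by simp

text \<open>
  A termwise Cauchy--Schwarz argument. The hypothesis says that, for each \<open>n\<close>, the \<open>n\<close>-th
  coefficients \<open>a, b, c\<close> of \<open>f, f', f''\<close> satisfy \<open>b\<^sup>2 < a c\<close>, so the quadratic form
  \<open>a u\<^sup>2 - 2 b u + c\<close> is positive for all \<open>u\<close>. Summation preserves this positivity, and the choice
  \<open>u = f'(x) / f(x)\<close>, the minimiser of the summed form, turns it into \<open>f'(x)\<^sup>2 < f(x) f''(x)\<close>.
\<close>

lemma powser_log_convex:
  fixes a :: "nat \<Rightarrow> real"
  assumes pos: "\<And>n. 0 < a n"
    and ratio: "\<And>n. real (n + 1) * (a (n + 1))\<^sup>2 < real (n + 2) * (a n * a (n + 2))"
    and summable: "\<And>y. \<bar>y\<bar> < r \<Longrightarrow> summable (\<lambda>n. a n * y ^ n)"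
    and x: "0 < x" "x < r"
  shows "(\<Sum>n. diffs a n * x ^ n)\<^sup>2 < (\<Sum>n. a n * x ^ n) * (\<Sum>n. diffs (diffs a) n * x ^ n)"
proof -
  define f f' f'' where "f = (\<Sum>n. a n * x ^ n)" and "f' = (\<Sum>n. diffs a n * x ^ n)"
    and "f'' = (\<Sum>n. diffs (diffs a) n * x ^ n)"
  define u where "u = f' / f"
  have f: "(\<lambda>n. a n * x ^ n) sums f"
    unfolding f_def by (intro summable_sums summable) (use x in auto)
  have f': "(\<lambda>n. diffs a n * x ^ n) sums f'"
    unfolding f'_def by (intro summable_sums summable_diffs_powser[of r] summable) (use x in auto)
  have f'': "(\<lambda>n. diffs (diffs a) n * x ^ n) sums f''"
    unfolding f''_def
    by (intro summable_sums summable_diffs_powser[of r] summable) (use x in auto)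
  have f_pos: "0 < f"
    unfolding f_def by (intro suminf_pos sums_summable[OF f] mult_pos_pos pos zero_less_power x)
  have quadratic: "0 < u\<^sup>2 * a n - 2 * u * diffs a n + diffs (diffs a) n" for n
  proof -
    have "(real (n + 1))\<^sup>2 * (a (n + 1))\<^sup>2 < real (n + 1) * real (n + 2) * (a n * a (n + 2))"
      using mult_strict_left_mono[OF ratio[of n], of "real (n + 1)"]
      by (simp add: power2_eq_square mult_ac)
    then have "(diffs a n)\<^sup>2 < a n * diffs (diffs a) n"
      by (simp add: diffs_def power_mult_distrib mult_ac)
    then have "0 < (u * a n - diffs a n)\<^sup>2 + (a n * diffs (diffs a) n - (diffs a n)\<^sup>2)"
      by (intro add_nonneg_pos) auto
    also have "\<dots> = a n * (u\<^sup>2 * a n - 2 * u * diffs a n + diffs (diffs a) n)"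
      by (simp add: power2_eq_square algebra_simps)
    finally show ?thesis
      using pos[of n] by (simp add: zero_less_mult_iff)
  qed
  have sums: "(\<lambda>n. u\<^sup>2 * (a n * x ^ n) - 2 * u * (diffs a n * x ^ n) + diffs (diffs a) n * x ^ n)
      sums (u\<^sup>2 * f - 2 * u * f' + f'')"
    by (intro sums_add sums_diff sums_mult f f' f'')
  have "0 < u\<^sup>2 * (a n * x ^ n) - 2 * u * (diffs a n * x ^ n) + diffs (diffs a) n * x ^ n" for n
    using mult_pos_pos[OF quadratic[of n], of "x ^ n"] x by (simp add: algebra_simps)
  then have "0 < u\<^sup>2 * f - 2 * u * f' + f''"
    using suminf_pos[OF sums_summable[OF sums]] sums_unique[OF sums] by simp
  also have "\<dots> = (f * f'' - f'\<^sup>2) / f"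
    using f_pos by (simp add: u_def field_simps power2_eq_square)
  finally show ?thesis
    using f_pos by (simp add: zero_less_divide_iff f_def f'_def f''_def)
qed

section \<open>The series of the complete elliptic integral\<close>

text \<open>
  Since \<open>(1, n) = n!\<close>, the two factorials in the hypergeometric series combine to a square.
\<close>

definition ellK_coeff :: "nat \<Rightarrow> real" where
  "ellK_coeff n = (pochhammer (1/2) n / fact n)\<^sup>2"

definition ellK :: "real \<Rightarrow> real" where
  "ellK x = (\<Sum>n. ellK_coeff n * x ^ n)"

definition ellK' :: "real \<Rightarrow> real" where
  "ellK' x = (\<Sum>n. diffs ellK_coeff n * x ^ n)"

definition ellK'' :: "real \<Rightarrow> real" where
  "ellK'' x = (\<Sum>n. diffs (diffs ellK_coeff) n * x ^ n)"

lemma hypergeo_F_eq_ellK: "hypergeo_F (1/2) (1/2) 1 x = ellK x"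
  unfolding hypergeo_F_def ellK_def ellK_coeff_def
  by (intro suminf_cong) (simp add: pochhammer_fact[symmetric] power2_eq_square)

lemma ellK_coeff_pos: "0 < ellK_coeff n"
  using pochhammer_pos[of "1/2 :: real" n] by (simp add: ellK_coeff_def)

text \<open>
  The two-term recurrence of the coefficients, from which both the differential equation and
  log-convexity are derived.
\<close>

lemma ellK_coeff_Suc: "(real n + 1)\<^sup>2 * ellK_coeff (n + 1) = (real n + 1/2)\<^sup>2 * ellK_coeff n"
proof -
  have "(real n + 1) * (pochhammer (1/2) (n + 1) / fact (n + 1))
      = (real n + 1/2) * (pochhammer (1/2) n / fact n :: real)"
    by (simp add: pochhammer_Suc divide_simps) (simp add: algebra_simps)
  then show ?thesis
    unfolding ellK_coeff_def power_mult_distrib[symmetric] by simp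
qed

lemma ellK_coeff_le_1: "ellK_coeff n \<le> 1"
proof (induction n)
  case 0
  show ?case by (simp add: ellK_coeff_def)
next
  case (Suc n)
  have "(real n + 1)\<^sup>2 * ellK_coeff (n + 1) \<le> (real n + 1)\<^sup>2 * 1"
    unfolding ellK_coeff_Suc
    by (intro mult_mono power_mono Suc.IH) (auto simp: less_imp_le[OF ellK_coeff_pos])
  then show ?case
    by (subst (asm) mult_le_cancel_left_pos) (auto intro: add_pos_nonneg)
qed

lemma summable_ellK:
  assumes "\<bar>x\<bar> < 1"
  shows "summable (\<lambda>n. ellK_coeff n * x ^ n)"
proof (rule summable_comparison_test')
  show "summable (\<lambda>n. \<bar>x\<bar> ^ n)"
    using assms by (simp add: summable_geometric)
  show "norm (ellK_coeff n * x ^ n) \<le> \<bar>x\<bar> ^ n" for n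
    using mult_right_mono[OF ellK_coeff_le_1[of n], of "\<bar>x\<bar> ^ n"] ellK_coeff_pos[of n]
    by (simp add: abs_mult power_abs)
qed

lemma summable_ellK':
  assumes "\<bar>x\<bar> < 1"
  shows "summable (\<lambda>n. diffs ellK_coeff n * x ^ n)"
  using summable_diffs_powser[OF summable_ellK assms] by blast

lemma summable_ellK'':
  assumes "\<bar>x\<bar> < 1"
  shows "summable (\<lambda>n. diffs (diffs ellK_coeff) n * x ^ n)"
  using summable_diffs_powser[OF summable_ellK' assms] by blast

lemma has_derivative_ellK:
  assumes "\<bar>x\<bar> < 1"
  shows "(ellK has_field_derivative ellK' x) (at x)"
  unfolding ellK_def[abs_def] ellK'_def
  using has_field_derivative_powser[OF summable_ellK assms] by blast

lemma has_derivative_ellK':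
  assumes "\<bar>x\<bar> < 1"
  shows "(ellK' has_field_derivative ellK'' x) (at x)"
  unfolding ellK'_def[abs_def] ellK''_def
  using has_field_derivative_powser[OF summable_ellK' assms] by blast

lemma ellK_pos:
  assumes "0 < x" "x < 1"
  shows "0 < ellK x"
  unfolding ellK_def
  using assms by (intro suminf_pos summable_ellK mult_pos_pos ellK_coeff_pos) auto

lemma ellK'_pos:
  assumes "0 < x" "x < 1"
  shows "0 < ellK' x"
  unfolding ellK'_def using assms
  by (intro suminf_pos summable_ellK' mult_pos_pos)
     (auto simp: diffs_def ellK_coeff_pos add_pos_nonneg)

text \<open>
  With \<open>N = n\<close> and consecutive coefficients \<open>a, b, c\<close>, the recurrence gives
  \<open>b / a = ((N + 1/2) / (N + 1))\<^sup>2\<close> and \<open>c / b = ((N + 3/2) / (N + 2))\<^sup>2\<close>. The coefficient condition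
  \<open>(N + 1) b\<^sup>2 < (N + 2) a c\<close> is therefore the statement that \<open>(N + 1/2)\<^sup>2 / (N + 1)\<close> grows
  strictly with \<open>N\<close>.
\<close>

lemma ellK_log_convex:
  assumes "0 < x" "x < 1"
  shows "(ellK' x)\<^sup>2 < ellK x * ellK'' x"
  unfolding ellK_def ellK'_def ellK''_def
proof (rule powser_log_convex[of ellK_coeff 1])
  fix n
  define N a b c where "N = real n" and "a = ellK_coeff n"
    and "b = ellK_coeff (n + 1)" and "c = ellK_coeff (n + 2)"
  have N: "0 \<le> N" and pos: "0 < a" "0 < b"
    by (simp_all add: N_def a_def b_def ellK_coeff_pos)
  have b: "(N + 1/2)\<^sup>2 * a = (N + 1)\<^sup>2 * b"
    using ellK_coeff_Suc[of n] by (simp add: N_def a_def b_def)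
  have c: "(N + 3/2)\<^sup>2 * b = (N + 2)\<^sup>2 * c"
    using ellK_coeff_Suc[of "n + 1"] by (simp add: N_def b_def c_def add_ac)
  have "(N + 3/2)\<^sup>2 * (N + 1) = (N + 1/2)\<^sup>2 * (N + 2) + (N\<^sup>2 + 3 * N + 7/4)"
    by (simp add: power2_eq_square field_simps)
  then have "(N + 1/2)\<^sup>2 * (N + 2) < (N + 3/2)\<^sup>2 * (N + 1)"
    using N by (simp add: add_nonneg_pos)
  then have "(N + 1/2)\<^sup>2 / (N + 1) < (N + 3/2)\<^sup>2 / (N + 2)"
    using N by (simp add: pos_less_divide_eq pos_divide_less_eq)
  then have "a * b * ((N + 1/2)\<^sup>2 / (N + 1)) < a * b * ((N + 3/2)\<^sup>2 / (N + 2))"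
    using pos by (intro mult_strict_left_mono) auto
  then have "b * ((N + 1/2)\<^sup>2 * a) / (N + 1) < a * ((N + 3/2)\<^sup>2 * b) / (N + 2)"
    by (simp add: mult_ac)
  then have "(N + 1) * b\<^sup>2 < (N + 2) * (a * c)"
    unfolding b c using N by (simp add: power2_eq_square mult_ac)
  then show "real (n + 1) * (ellK_coeff (n + 1))\<^sup>2
      < real (n + 2) * (ellK_coeff n * ellK_coeff (n + 2))"
    by (simp add: N_def a_def b_def c_def add_ac)
qed (use assms in \<open>auto intro: ellK_coeff_pos summable_ellK\<close>)

text \<open>
  The hypergeometric equation for the parameters \<open>1/2, 1/2, 1\<close>. The coefficient of \<open>x\<^sup>n\<close> in the
  difference of the two sides is \<open>(n + 1)\<^sup>2 a\<^sub>n\<^sub>+\<^sub>1 - (n + 1/2)\<^sup>2 a\<^sub>n\<close>, which is zero by the recurrence.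
\<close>

lemma ellK_ode:
  assumes "\<bar>x\<bar> < 1"
  shows "x * (1 - x) * ellK'' x + (1 - 2 * x) * ellK' x = ellK x / 4"
proof -
  let ?a = ellK_coeff
  have f: "(\<lambda>n. ?a n * x ^ n) sums ellK x"
    and f': "(\<lambda>n. diffs ?a n * x ^ n) sums ellK' x"
    and f'': "(\<lambda>n. diffs (diffs ?a) n * x ^ n) sums ellK'' x"
    unfolding ellK_def ellK'_def ellK''_def
    by (intro summable_sums summable_ellK summable_ellK' summable_ellK'' assms)+
  \<comment> \<open>Multiplying by \<open>x\<close> shifts indices; the new zeroth terms carry a factor \<open>n\<close> and vanish.\<close>
  have xf': "(\<lambda>n. real n * ?a n * x ^ n) sums (x * ellK' x)"
    using sums_mult[OF f', of x]
    by (subst sums_Suc_iff[symmetric, where f = "\<lambda>n. real n * ?a n * x ^ n", simplified])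
       (simp add: diffs_def mult_ac)
  have xf'': "(\<lambda>n. real n * diffs ?a n * x ^ n) sums (x * ellK'' x)"
    using sums_mult[OF f'', of x]
    by (subst sums_Suc_iff[symmetric, where f = "\<lambda>n. real n * diffs ?a n * x ^ n", simplified])
       (simp add: diffs_def mult_ac)
  have xxf'': "(\<lambda>n. real n * (real n - 1) * ?a n * x ^ n) sums (x * (x * ellK'' x))"
    using sums_mult[OF xf'', of x]
    by (subst sums_Suc_iff[symmetric, where f = "\<lambda>n. real n * (real n - 1) * ?a n * x ^ n", simplified])
       (simp add: diffs_def mult_ac)
  have "(\<lambda>n. real n * diffs ?a n * x ^ n - real n * (real n - 1) * ?a n * x ^ n
        + (diffs ?a n * x ^ n - 2 * (real n * ?a n * x ^ n)))
      sums (x * ellK'' x - x * (x * ellK'' x) + (ellK' x - 2 * (x * ellK' x)))"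
    by (intro sums_add sums_diff sums_mult f' xf' xf'' xxf'')
  moreover have "real n * diffs ?a n * x ^ n - real n * (real n - 1) * ?a n * x ^ n
        + (diffs ?a n * x ^ n - 2 * (real n * ?a n * x ^ n)) = 1/4 * (?a n * x ^ n)" for n
  proof -
    have "real n * diffs ?a n - real n * (real n - 1) * ?a n + (diffs ?a n - 2 * (real n * ?a n))
        = (real n + 1)\<^sup>2 * ?a (n + 1) - (real n + 1/2)\<^sup>2 * ?a n + 1/4 * ?a n"
      by (simp add: diffs_def power2_eq_square algebra_simps)
    also have "\<dots> = 1/4 * ?a n"
      by (simp only: ellK_coeff_Suc)
    finally show ?thesis
      by (metis (no_types, opaque_lifting) left_diff_distrib distrib_right mult.assoc)
  qed
  ultimately have "(\<lambda>n. 1/4 * (?a n * x ^ n))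
      sums (x * ellK'' x - x * (x * ellK'' x) + (ellK' x - 2 * (x * ellK' x)))"
    by simp
  from sums_unique2[OF this sums_mult[OF f, of "1/4"]] show ?thesis
    by (simp add: algebra_simps)
qed

section \<open>Complementary arguments\<close>

lemma has_derivative_ellK_complement:
  assumes "0 < x" "x < 1"
  shows "((\<lambda>y. ellK (1 - y)) has_field_derivative - ellK' (1 - x)) (at x)"
    and "((\<lambda>y. ellK' (1 - y)) has_field_derivative - ellK'' (1 - x)) (at x)"
proof -
  have "((\<lambda>y. 1 - y) has_field_derivative -1) (at x)"
    by (auto intro!: derivative_eq_intros)
  moreover have "\<bar>1 - x\<bar> < 1" using assms by auto
  ultimately show "((\<lambda>y. ellK (1 - y)) has_field_derivative - ellK' (1 - x)) (at x)"
    and "((\<lambda>y. ellK' (1 - y)) has_field_derivative - ellK'' (1 - x)) (at x)"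
    using DERIV_chain2[OF has_derivative_ellK] DERIV_chain2[OF has_derivative_ellK'] by fastforce+
qed

text \<open>
  The derivative of the weighted Wronskian vanishes: it is \<open>f(1 - x)\<close> times the left-hand side of the
  equation at \<open>x\<close> minus \<open>f(x)\<close> times the one at \<open>1 - x\<close>, that is
  \<open>f(1 - x) f(x) / 4 - f(x) f(1 - x) / 4\<close>. The sign of the constant is visible at any point.
\<close>

lemma ellK_wronskian_const:
  obtains W where "0 < W"
    and "\<And>x. 0 < x \<Longrightarrow> x < 1 \<Longrightarrow> x * (1 - x) * (ellK' x * ellK (1 - x) + ellK x * ellK' (1 - x)) = W"
proof -
  define w where "w x = x * (1 - x) * (ellK' x * ellK (1 - x) + ellK x * ellK' (1 - x))" for x
  have deriv: "(w has_field_derivative 0) (at x)" if x: "0 < x" "x < 1" for x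
  proof -
    have "\<bar>x\<bar> < 1" "\<bar>1 - x\<bar> < 1" using x by auto
    note ode = ellK_ode[OF this(1)] ellK_ode[OF this(2)]
      and d = has_derivative_ellK[OF this(1)] has_derivative_ellK'[OF this(1)]
    let ?f = "ellK x" and ?g = "ellK (1 - x)" and ?f' = "ellK' x" and ?g' = "ellK' (1 - x)"
      and ?f'' = "ellK'' x" and ?g'' = "ellK'' (1 - x)"
    have "(w has_field_derivative
        (1 - 2 * x) * (?f' * ?g + ?f * ?g')
        + x * (1 - x) * ((?f'' * ?g - ?f' * ?g') + (?f' * ?g' - ?f * ?g''))) (at x)"
      unfolding w_def
      by (rule derivative_eq_intros d has_derivative_ellK_complement x refl)+ (simp add: algebra_simps)
    also have "(1 - 2 * x) * (?f' * ?g + ?f * ?g')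
        + x * (1 - x) * ((?f'' * ?g - ?f' * ?g') + (?f' * ?g' - ?f * ?g''))
      = ?g * (x * (1 - x) * ?f'' + (1 - 2 * x) * ?f')
        - ?f * ((1 - x) * (1 - (1 - x)) * ?g'' + (1 - 2 * (1 - x)) * ?g')"
      by (simp add: algebra_simps)
    also have "\<dots> = 0"
      unfolding ode by simp
    finally show ?thesis .
  qed
  have const: "w x = w (1/2)" if "0 < x" "x < 1" for x
  proof -
    have "(w has_field_derivative 0) (at y within {0<..<1})" if "y \<in> {0<..<1}" for y
      using that by (auto intro: has_field_derivative_at_within[OF deriv])
    then obtain c where "w y = c" if "y \<in> {0<..<1}" for y
      using has_field_derivative_zero_constant[of "{0<..<1}" w] by auto
    then show ?thesis using that by simp
  qed
  show thesis
  proof (rule that)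
    show "0 < w (1/2)"
      by (simp add: w_def ellK_pos ellK'_pos add_pos_pos)
  qed (use const in \<open>simp add: w_def\<close>)
qed

text \<open>
  By log-convexity \<open>f' / f\<close> is strictly increasing. For \<open>z > 1/2\<close> its value at \<open>z\<close> exceeds that at
  \<open>1 - z\<close>, and this says exactly that the derivative of \<open>f(z) f(1 - z)\<close> is positive.
\<close>

lemma ellK_complement_product_strict_mono:
  assumes "1/2 \<le> x" "x < y" "y < 1"
  shows "ellK x * ellK (1 - x) < ellK y * ellK (1 - y)"
proof -
  have ratio_mono: "ellK' u / ellK u < ellK' v / ellK v" if "0 < u" "u < v" "v < 1" for u v
  proof (rule DERIV_pos_imp_increasing[OF \<open>u < v\<close>])
    fix z assume "u \<le> z" "z \<le> v"
    then have z: "0 < z" "z < 1" "\<bar>z\<bar> < 1" and nz: "ellK z \<noteq> 0"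
      using that ellK_pos[of z] by auto
    have "((\<lambda>z. ellK' z / ellK z) has_field_derivative
        (ellK'' z * ellK z - ellK' z * ellK' z) / (ellK z * ellK z)) (at z)"
      by (intro DERIV_divide has_derivative_ellK has_derivative_ellK' z nz)
    moreover have "0 < (ellK'' z * ellK z - ellK' z * ellK' z) / (ellK z * ellK z)"
      using ellK_log_convex[OF z(1,2)] ellK_pos[OF z(1,2)]
      by (intro divide_pos_pos) (auto simp: power2_eq_square mult_ac)
    ultimately show "\<exists>d. ((\<lambda>z. ellK' z / ellK z) has_field_derivative d) (at z) \<and> 0 < d"
      by blast
  qed
  have deriv: "((\<lambda>z. ellK z * ellK (1 - z)) has_field_derivative
      ellK' z * ellK (1 - z) - ellK z * ellK' (1 - z)) (at z)" if "0 < z" "z < 1" for z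
    using DERIV_mult[OF has_derivative_ellK has_derivative_ellK_complement(1), of z] that
    by (simp add: mult_ac)
  show ?thesis
  proof (rule DERIV_pos_imp_increasing_open[OF \<open>x < y\<close>])
    fix z assume "x < z" "z < y"
    then have z: "1/2 < z" "0 < z" "z < 1" using assms by auto
    have "ellK' (1 - z) / ellK (1 - z) < ellK' z / ellK z"
      using z by (intro ratio_mono) auto
    then have "0 < ellK' z * ellK (1 - z) - ellK z * ellK' (1 - z)"
      using ellK_pos[of z] ellK_pos[of "1 - z"] z by (simp add: field_simps)
    then show "\<exists>d. ((\<lambda>z. ellK z * ellK (1 - z)) has_field_derivative d) (at z) \<and> 0 < d"
      using deriv z by blast
  next
    show "continuous_on {x..y} (\<lambda>z. ellK z * ellK (1 - z))"
      by (rule DERIV_continuous_on[OF has_field_derivative_at_within[OF deriv]]) (use assms in auto)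
  qed
qed

section \<open>Chord slopes and subadditivity\<close>

text \<open>
  The numerator \<open>u f'(u) - f(u)\<close> of the derivative of \<open>f(u) / u\<close> equals \<open>u (f'(u) - f'(z))\<close> for
  some \<open>z\<close> between \<open>0\<close> and \<open>u\<close>, by the mean value theorem and \<open>f 0 = 0\<close>; so it is negative.
\<close>

lemma strict_antimono_on_div_ident:
  fixes f f' :: "real \<Rightarrow> real"
  assumes deriv: "\<And>t. 0 \<le> t \<Longrightarrow> (f has_field_derivative f' t) (at t)"
    and decr: "\<And>s t. 0 \<le> s \<Longrightarrow> s < t \<Longrightarrow> f' t < f' s"
    and zero: "f 0 = 0"
  shows "strict_antimono_on {0<..} (\<lambda>t. f t / t)"
proof (rule monotone_onI)
  fix s t :: real
  assume st: "s \<in> {0<..}" "t \<in> {0<..}" "s < t"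
  show "f t / t < f s / s"
  proof (rule DERIV_neg_imp_decreasing[OF \<open>s < t\<close>])
    fix u assume "s \<le> u" "u \<le> t"
    then have u: "0 < u" using st by auto
    obtain z where z: "0 < z" "z < u" "f u - f 0 = (u - 0) * f' z"
      using MVT2[of 0 u f f'] deriv u by auto
    have "u * f' u < u * f' z"
      using decr[of z u] z u by simp
    then have "(f' u * u - f u * 1) / (u * u) < 0"
      using z u zero by (intro divide_neg_pos) (auto simp: mult_ac)
    moreover have "((\<lambda>u. f u / u) has_field_derivative (f' u * u - f u * 1) / (u * u)) (at u)"
      using u by (intro DERIV_divide deriv DERIV_ident) auto
    ultimately show "\<exists>d. ((\<lambda>u. f u / u) has_field_derivative d) (at u) \<and> d < 0"
      by blast
  qed
qed

text \<open>
  Split \<open>f (s + t)\<close> as \<open>q s + q t\<close>, where \<open>q = f (s + t) / (s + t)\<close> is at most \<open>f s / s\<close> and at most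
  \<open>f t / t\<close>.
\<close>

lemma subadditive_if_antimono_on_div_ident:
  fixes f :: "real \<Rightarrow> real"
  assumes "antimono_on {0<..} (\<lambda>t. f t / t)" and "0 < s" "0 < t"
  shows "f (s + t) \<le> f s + f t"
proof -
  let ?q = "f (s + t) / (s + t)"
  have "?q \<le> f s / s" "?q \<le> f t / t"
    using assms by (auto intro: monotone_onD[OF assms(1)])
  then have "?q * s \<le> f s" "?q * t \<le> f t"
    using assms by (simp_all add: pos_le_divide_eq)
  moreover have "f (s + t) = ?q * s + ?q * t"
    using assms by (simp only: distrib_left[symmetric]) simp
  ultimately show ?thesis by linarith
qed

section \<open>The function \<open>\<phi>\<close>\<close>

text \<open>
  The usual logistic function evaluated at \<open>t / 2\<close>; this scaling makes it the argument in \<open>\<phi>\<close>.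
\<close>

definition logistic :: "real \<Rightarrow> real" where
  "logistic t = exp (t/2) / (1 + exp (t/2))"

lemma logistic_bounds: "0 < logistic t" "logistic t < 1"
  by (simp_all add: logistic_def add_pos_pos divide_simps)

lemma one_minus_logistic: "1 - logistic t = 1 / (1 + exp (t/2))"
proof -
  have "1 + exp (t/2) \<noteq> 0"
    using add_pos_pos[of 1 "exp (t/2)"] by simp
  then show ?thesis
    by (simp add: logistic_def diff_divide_eq_iff)
qed

lemma phi_eq: "phi t = ln (ellK (logistic t) / ellK (1 - logistic t))"
  unfolding phi_def hypergeo_F_eq_ellK one_minus_logistic by (simp add: logistic_def)

lemma has_derivative_logistic:
  "(logistic has_field_derivative logistic t * (1 - logistic t) / 2) (at t)"
proof -
  have nz: "1 + exp (t/2) \<noteq> 0"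
    using add_pos_pos[of 1 "exp (t/2)"] by simp
  have d: "((\<lambda>t. exp (t/2)) has_field_derivative exp (t/2) / 2) (at t)"
    by (auto intro!: derivative_eq_intros)
  have "(logistic has_field_derivative
      (exp (t/2) / 2 * (1 + exp (t/2)) - exp (t/2) * (0 + exp (t/2) / 2))
        / ((1 + exp (t/2)) * (1 + exp (t/2)))) (at t)"
    unfolding logistic_def[abs_def] by (intro DERIV_divide DERIV_add DERIV_const d nz)
  also have "exp (t/2) / 2 * (1 + exp (t/2)) - exp (t/2) * (0 + exp (t/2) / 2) = exp (t/2) / 2"
    by (simp add: distrib_left)
  also have "exp (t/2) / 2 / ((1 + exp (t/2)) * (1 + exp (t/2))) = logistic t * (1 - logistic t) / 2"
    unfolding one_minus_logistic unfolding logistic_def by simp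
  finally show ?thesis .
qed

lemma logistic_strict_mono:
  assumes "s < t" shows "logistic s < logistic t"
proof (rule DERIV_pos_imp_increasing[OF assms])
  fix z
  have "0 < logistic z * (1 - logistic z) / 2"
    using logistic_bounds[of z] by simp
  then show "\<exists>d. (logistic has_field_derivative d) (at z) \<and> 0 < d"
    using has_derivative_logistic by blast
qed

text \<open>
  The factor \<open>x (1 - x)\<close> in the derivative of the logistic function is just the weight that turns
  the numerator \<open>f'(x) f(1 - x) + f(x) f'(1 - x)\<close> into the constant Wronskian.
\<close>

lemma has_derivative_phi:
  assumes W: "\<And>x. 0 < x \<Longrightarrow> x < 1 \<Longrightarrow>
    x * (1 - x) * (ellK' x * ellK (1 - x) + ellK x * ellK' (1 - x)) = W"
  shows "(phi has_field_derivative W / (2 * (ellK (logistic t) * ellK (1 - logistic t)))) (at t)"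
proof -
  define x where "x = logistic t"
  have x: "0 < x" "x < 1" "\<bar>x\<bar> < 1" using logistic_bounds[of t] by (auto simp: x_def)
  define f g f' g' where "f = ellK x" and "g = ellK (1 - x)" and "f' = ellK' x" and "g' = ellK' (1 - x)"
  have pos: "0 < f" "0 < g" unfolding f_def g_def using x by (auto intro!: ellK_pos)
  have "((\<lambda>x. ellK x / ellK (1 - x)) has_field_derivative (f' * g + f * g') / (g * g)) (at x)"
    using DERIV_divide[OF has_derivative_ellK[OF x(3)] has_derivative_ellK_complement(1)[OF x(1,2)]]
      pos by (simp add: f_def g_def f'_def g'_def)
  from DERIV_chain2[OF DERIV_ln this]
  have "((\<lambda>x. ln (ellK x / ellK (1 - x))) has_field_derivative
      g / f * ((f' * g + f * g') / (g * g))) (at x)"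
    using pos by (simp add: f_def g_def)
  from DERIV_chain2[OF this[unfolded x_def] has_derivative_logistic]
  have "(phi has_field_derivative
      g / f * ((f' * g + f * g') / (g * g)) * (x * (1 - x) / 2)) (at t)"
    by (simp add: phi_eq[abs_def] x_def)
  also have "g / f * ((f' * g + f * g') / (g * g)) * (x * (1 - x) / 2)
      = x * (1 - x) * (f' * g + f * g') / (2 * (f * g))"
    using pos by (simp add: field_simps)
  also have "x * (1 - x) * (f' * g + f * g') = W"
    unfolding f_def g_def f'_def g'_def by (rule W) (use x in auto)
  finally show ?thesis by (simp add: f_def g_def x_def)
qed

theorem corollary4p5:
  shows "strict_antimono_on {0<..} (\<lambda>t::real. phi t / t) \<and>
         (\<forall>t>0. \<forall>t'>0. phi (t + t') \<le> phi t + phi t')"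
proof -
  obtain W where W_pos: "0 < W"
    and W: "\<And>x. 0 < x \<Longrightarrow> x < 1 \<Longrightarrow>
      x * (1 - x) * (ellK' x * ellK (1 - x) + ellK x * ellK' (1 - x)) = W"
    using ellK_wronskian_const by blast
  let ?P = "\<lambda>t. ellK (logistic t) * ellK (1 - logistic t)"
  have logistic_0: "logistic 0 = 1/2"
    by (simp add: logistic_def)
  have decr: "W / (2 * ?P t) < W / (2 * ?P s)" if st: "0 \<le> s" "s < t" for s t
  proof -
    have "1/2 \<le> logistic s"
      using logistic_strict_mono[of 0 s] st by (cases "s = 0") (auto simp: logistic_0)
    then have "?P s < ?P t"
      by (intro ellK_complement_product_strict_mono logistic_strict_mono st logistic_bounds)
    moreover have "0 < ?P s"
      using logistic_bounds[of s] by (intro mult_pos_pos ellK_pos) auto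
    ultimately show ?thesis
      using W_pos by (intro frac_less2) auto
  qed
  have zero: "phi 0 = 0"
    using ellK_pos[of "1/2"] by (simp add: phi_eq logistic_0)
  have quotient: "strict_antimono_on {0<..} (\<lambda>t::real. phi t / t)"
    by (rule strict_antimono_on_div_ident[OF has_derivative_phi[OF W] decr zero])
  moreover have "antimono_on {0<..} (\<lambda>t::real. phi t / t)"
    using quotient by (rule strict_antimono_iff_antimono[THEN iffD1, THEN conjunct1])
  ultimately show ?thesis
    using subadditive_if_antimono_on_div_ident[of phi] by blast
qed

end
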